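(* Let $\lambda\vdash N$ and $r\geq0$. Then $$\mathcal G_rY_\lambda(x,y)=\sum_{\substack{\nu\supseteq\lambda\\ \nu/\lambda\text{ is a horizontal }r\text{-strip}}}Y_\nu(x,y).$$
   Context: With $D=\partial_x+\partial_y$, the operators on $\mathbb Q[x,y]$ are $\mathcal G_0=\mathrm{id}$ and $\mathcal G_r=y^r\sum_{j=1}^{r}\binom{r-1}{j-1}\frac{x^j}{j!}D^j$ for $r\geq1$. For a partition $\lambda\vdash N$, $\mathrm{SYT}(\lambda)$ is the set of standard Young tableaux of shape $\lambda$ (fillings of the Young diagram, in English convention, by $1,\ldots,N$ each used once, increasing along rows and down columns). For $T\in\mathrm{SYT}(\lambda)$, $\mathrm{Des}(T)=\{j\in[N-1]: j+1\text{ lies in a lower row than }j\}$, and $$Y_\lambda(x,y)=\sum_{T\in\mathrm{SYT}(\lambda)}x^{|\mathrm{Des}(T)|+1}y^{N-|\mathrm{Des}(T)|}.$$ For the empty partition this gives $Y_\varnothing=x$. A horizontal $r$-strip is a skew diagram with $r$ cells, no two in the same column; the empty skew diagram is a horizontal $0$-strip. *)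

theory Defs
  imports "HOL-Computational_Algebra.Polynomial" "HOL-Library.FuncSet"
begin

text \<open>
  The ring \<open>\<rat>[x,y]\<close> is modelled as \<open>\<rat>[x][y]\<close>, i.e. the type \<open>rat poly poly\<close>:
  \<open>y\<close> is the outer variable, and the coefficients are polynomials in \<open>x\<close>.
\<close>

definition varx :: "rat poly poly" where
  "varx = [:[:0, 1:]:]"

definition vary :: "rat poly poly" where
  "vary = [:0, 1:]"

definition dx :: "rat poly poly \<Rightarrow> rat poly poly" where
  "dx p = map_poly pderiv p"

definition dy :: "rat poly poly \<Rightarrow> rat poly poly" where
  "dy p = pderiv p"

definition diffD :: "rat poly poly \<Rightarrow> rat poly poly" where
  "diffD p = dx p + dy p"

definition opG :: "nat \<Rightarrow> rat poly poly \<Rightarrow> rat poly poly" where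
  "opG r p =
     (if r = 0 then p
      else vary ^ r *
        (\<Sum>j = 1..r. smult [:of_nat ((r - 1) choose (j - 1)):]
          (smult [:1 / fact j:] (varx ^ j) * (diffD ^^ j) p)))"

text \<open>
  Partitions are weakly decreasing lists of positive parts; the empty list is the empty
  partition.  A cell is a pair (row, column), both counted from 0, with rows numbered
  from top to bottom (English convention).
\<close>

definition is_partition :: "nat list \<Rightarrow> bool" where
  "is_partition lam \<longleftrightarrow> sorted_wrt (\<ge>) lam \<and> (\<forall>k\<in>set lam. 0 < k)"

definition partition_of :: "nat list \<Rightarrow> nat \<Rightarrow> bool" where
  "partition_of lam N \<longleftrightarrow> is_partition lam \<and> sum_list lam = N"

definition diagram :: "nat list \<Rightarrow> (nat \<times> nat) set" where
  "diagram lam = {(i, j). i < length lam \<and> j < lam ! i}"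

text \<open>
  Fillings are taken to be extensional functions, so that two fillings which agree on the
  diagram are equal and every tableau is counted exactly once.
\<close>

definition SYT :: "nat list \<Rightarrow> (nat \<times> nat \<Rightarrow> nat) set" where
  "SYT lam = {T \<in> extensional (diagram lam).
     bij_betw T (diagram lam) {1..sum_list lam} \<and>
     (\<forall>i j j'. (i, j) \<in> diagram lam \<and> (i, j') \<in> diagram lam \<and> j < j' \<longrightarrow> T (i, j) < T (i, j')) \<and>
     (\<forall>i i' j. (i, j) \<in> diagram lam \<and> (i', j) \<in> diagram lam \<and> i < i' \<longrightarrow> T (i, j) < T (i', j))}"

definition Des :: "nat list \<Rightarrow> (nat \<times> nat \<Rightarrow> nat) \<Rightarrow> nat set" where
  "Des lam T = {k \<in> {1..<sum_list lam}.
     \<exists>c\<in>diagram lam. \<exists>d\<in>diagram lam. T c = k \<and> T d = k + 1 \<and> fst c < fst d}"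

definition Ypoly :: "nat list \<Rightarrow> rat poly poly" where
  "Ypoly lam = (\<Sum>T\<in>SYT lam.
     varx ^ (card (Des lam T) + 1) * vary ^ (sum_list lam - card (Des lam T)))"

definition horizontal_strip :: "nat list \<Rightarrow> nat list \<Rightarrow> nat \<Rightarrow> bool" where
  "horizontal_strip lam nu r \<longleftrightarrow>
     diagram lam \<subseteq> diagram nu \<and>
     card (diagram nu - diagram lam) = r \<and>
     inj_on snd (diagram nu - diagram lam)"

end

theory Submission
  imports Defs
begin

text \<open>
  Let \<open>f\<^sub>k(\<lambda>)\<close> be the number of semistandard tableaux of shape \<open>\<lambda>\<close> with entries in \<open>[k]\<close>.
  Standardization gives \<open>f\<^sub>k(\<lambda>) = \<Sum>\<^sub>T (N + k - 1 - |Des T| choose N)\<close>, and these numbers for all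
  \<open>k \<ge> 1\<close> determine \<open>Y\<^sub>\<lambda>\<close>.  The Pieri rule specialized at \<open>1\<^sup>k\<close> says that the sum of \<open>f\<^sub>k(\<nu>)\<close> over
  the horizontal \<open>r\<close>-strips \<open>\<nu>/\<lambda>\<close> is \<open>(k + r - 1 choose r) f\<^sub>k(\<lambda>)\<close>.  On the other side \<open>D\<close> kills
  \<open>z = y - x\<close>, so \<open>G\<^sub>r\<close> maps \<open>x\<^sup>m z\<^sup>l\<close> to \<open>(m + r - 1 choose r) x\<^sup>m z\<^sup>l (x + z)\<^sup>r\<close>; expanding \<open>Y\<^sub>\<lambda>\<close>
  in powers of \<open>x\<close> and \<open>z\<close>, Vandermonde's identity shows that \<open>G\<^sub>r\<close> too multiplies the sequence
  \<open>f\<^sub>k\<close> by \<open>(k + r - 1 choose r)\<close>.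
\<close>

section \<open>Interlacing shapes and the Pieri rule\<close>

definition shape_size :: "(nat \<Rightarrow> nat) \<Rightarrow> nat" where
  "shape_size f = (\<Sum>i | f i \<noteq> 0. f i)"

text \<open>Row lengths form a total function that is eventually zero, so rows can be compared and
  shifted without reference to a number of parts.\<close>

definition shape :: "(nat \<Rightarrow> nat) \<Rightarrow> bool" where
  "shape f \<longleftrightarrow> antimono f \<and> finite {i. f i \<noteq> 0}"

text \<open>For shapes this means that \<open>f/m\<close> is a horizontal strip: row
  \<open>Suc i\<close> of \<open>f\<close> ends no later than row \<open>i\<close> of
  \<open>m\<close>, so no column receives two new cells.\<close>

definition interlace :: "(nat \<Rightarrow> nat) \<Rightarrow> (nat \<Rightarrow> nat) \<Rightarrow> bool" where
  "interlace m f \<longleftrightarrow> (\<forall>i. m i \<le> f i \<and> f (Suc i) \<le> m i)"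

definition strips_above :: "nat \<Rightarrow> (nat \<Rightarrow> nat) \<Rightarrow> (nat \<Rightarrow> nat) set" where
  "strips_above r f = {g. interlace f g \<and> shape_size g = shape_size f + r}"

definition strips_below :: "(nat \<Rightarrow> nat) \<Rightarrow> (nat \<Rightarrow> nat) set" where
  "strips_below f = {m. interlace m f}"

text \<open>
  A semistandard tableau is built up by one horizontal strip for each of the entries \<open>1, \<dots>, k\<close>.
\<close>

fun num_ssyt :: "nat \<Rightarrow> (nat \<Rightarrow> nat) \<Rightarrow> nat" where
  "num_ssyt 0 f = (if f = (\<lambda>_. 0) then 1 else 0)"
| "num_ssyt (Suc k) f = (\<Sum>m\<in>strips_below f. num_ssyt k m)"

section \<open>Elementary facts on shapes and interlacing; finiteness of the strip sets\<close>

lemma support_subset: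
  fixes f :: "nat \<Rightarrow> nat"
  assumes "\<And>i. i \<ge> n \<Longrightarrow> f i = 0"
  shows "{i. f i \<noteq> 0} \<subseteq> {..<n}"
proof
  fix i assume "i \<in> {i. f i \<noteq> 0}"
  then have "\<not> i \<ge> n" using assms[of i] by auto
  then show "i \<in> {..<n}" by simp
qed

lemma shape_size_eq:
  assumes "\<And>i. i \<ge> n \<Longrightarrow> f i = 0"
  shows "shape_size f = sum f {..<n}"
  unfolding shape_size_def by (rule sum.mono_neutral_left) (use support_subset[of n f] assms in auto)

lemma finite_support_iff:
  fixes f :: "nat \<Rightarrow> nat"
  shows "finite {i. f i \<noteq> 0} \<longleftrightarrow> (\<exists>n. \<forall>i\<ge>n. f i = 0)"
proof
  assume "finite {i. f i \<noteq> 0}"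
  then obtain n where "\<forall>i\<in>{i. f i \<noteq> 0}. i < n" unfolding finite_nat_set_iff_bounded by blast
  then have "f i = 0" if "i \<ge> n" for i using that by fastforce
  then show "\<exists>n. \<forall>i\<ge>n. f i = 0" by blast
next
  assume "\<exists>n. \<forall>i\<ge>n. f i = 0"
  then obtain n where "\<forall>i\<ge>n. f i = 0" by blast
  then have "{i. f i \<noteq> 0} \<subseteq> {..<n}" by (intro support_subset) auto
  then show "finite {i. f i \<noteq> 0}" using finite_subset by blast
qed

lemma shape_alt: "shape f \<longleftrightarrow> (\<forall>i. f (Suc i) \<le> f i) \<and> (\<exists>n. \<forall>i\<ge>n. f i = 0)"
  unfolding shape_def finite_support_iff by (simp add: antimono_iff_le_Suc)

lemma shape_antimono: "shape f \<Longrightarrow> i \<le> j \<Longrightarrow> f j \<le> f i"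
  unfolding shape_def by (auto dest: antimonoD)

lemma interlace_shape_above:
  assumes "interlace m f" "shape m"
  shows "shape f"
proof -
  obtain n where n: "\<forall>i\<ge>n. m i = 0" using assms(2) unfolding shape_alt by blast
  have "f i = 0" if "i \<ge> Suc n" for i
  proof -
    have "f (Suc (i - 1)) \<le> m (i - 1)" using assms(1) unfolding interlace_def by blast
    moreover have "m (i - 1) = 0" using n that by auto
    ultimately show ?thesis using that by simp
  qed
  moreover have "f (Suc i) \<le> f i" for i
    using assms(1) unfolding interlace_def using order_trans by blast
  ultimately show ?thesis unfolding shape_alt by blast
qed

lemma interlace_shape_below:
  assumes "interlace m f" "shape f"
  shows "shape m"
proof -
  obtain n where n: "\<forall>i\<ge>n. f i = 0" using assms(2) unfolding shape_alt by blast
  have "m i = 0" if "i \<ge> n" for i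
    using assms(1) n that unfolding interlace_def by (metis le_zero_eq)
  moreover have "m (Suc i) \<le> m i" for i
    using assms(1) unfolding interlace_def using order_trans by blast
  ultimately show ?thesis unfolding shape_alt by blast
qed

lemma interlace_refl: "shape f \<Longrightarrow> interlace f f"
  unfolding interlace_def shape_alt by auto

lemma finite_bounded_functions:
  "finite {g::nat \<Rightarrow> nat. (\<forall>i. g i \<le> b) \<and> (\<forall>i\<ge>n. g i = 0)}" (is "finite ?S")
proof -
  have "inj_on (\<lambda>g. restrict g {..<n}) ?S"
  proof (rule inj_onI)
    fix g h assume *: "g \<in> ?S" "h \<in> ?S" "restrict g {..<n} = restrict h {..<n}"
    show "g = h"
    proof
      fix i show "g i = h i"
        using *(1,2) fun_cong[OF *(3), of i] by (cases "i < n") (auto simp del: fun_eq_iff simp: restrict_apply)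
    qed
  qed
  moreover have "(\<lambda>g. restrict g {..<n}) ` ?S \<subseteq> {..<n} \<rightarrow>\<^sub>E {..b}" by (auto simp: PiE_def)
  moreover have "finite ({..<n} \<rightarrow>\<^sub>E {..b})" by (intro finite_PiE) auto
  ultimately show ?thesis using finite_imageD finite_subset by blast
qed

lemma finite_strips_below:
  assumes "shape f" shows "finite (strips_below f)"
proof -
  obtain n where n: "\<forall>i\<ge>n. f i = 0" using assms unfolding shape_alt by blast
  have le: "m i \<le> f i" if "interlace m f" for m i using that unfolding interlace_def by blast
  have "f i \<le> f 0" for i using assms shape_antimono by blast
  then have "strips_below f \<subseteq> {g. (\<forall>i. g i \<le> f 0) \<and> (\<forall>i\<ge>n. g i = 0)}"
    unfolding strips_below_def using le n by (auto intro: order_trans) (metis le_zero_eq)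
  then show ?thesis using finite_bounded_functions finite_subset by blast
qed

text \<open>Interlacing allows at most one row below those of \<open>f\<close>, but leaves row 0
  unbounded; the prescribed size bounds that row.\<close>

lemma finite_strips_above:
  assumes "shape f" shows "finite (strips_above r f)"
proof -
  obtain n where n: "\<forall>i\<ge>n. f i = 0" using assms unfolding shape_alt by blast
  have "(\<forall>i. g i \<le> shape_size f + r) \<and> (\<forall>i\<ge>Suc n. g i = 0)" if "g \<in> strips_above r f" for g
  proof -
    have g: "interlace f g" "shape_size g = shape_size f + r"
      using that by (auto simp: strips_above_def)
    then have "shape g" using assms interlace_shape_above by blast
    then have fin: "finite {i. g i \<noteq> 0}" by (simp add: shape_def)
    have "g i \<le> shape_size g" for i
      using member_le_sum[OF _ _ fin, of i g] unfolding shape_size_def by (cases "g i = 0") auto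
    moreover have "g i = 0" if "i \<ge> Suc n" for i
    proof -
      have "g (Suc (i - 1)) \<le> f (i - 1)" using g(1) unfolding interlace_def by blast
      moreover have "f (i - 1) = 0" using n that by auto
      ultimately show ?thesis using that by simp
    qed
    ultimately show ?thesis using g(2) by simp
  qed
  then have "strips_above r f \<subseteq> {g. (\<forall>i. g i \<le> shape_size f + r) \<and> (\<forall>i\<ge>Suc n. g i = 0)}"
    by blast
  then show ?thesis using finite_bounded_functions finite_subset by blast
qed

text \<open>
  For fixed \<open>f\<close> and \<open>m\<close>, the conditions on a common lower neighbour \<open>k\<close> put \<open>k i\<close> into the interval
  from \<open>max (f (Suc i)) (m (Suc i))\<close> to \<open>min (f i) (m i)\<close>, and those on a common upper neighbour \<open>g\<close>
  put \<open>g (Suc i)\<close> into the same interval; only \<open>g 0\<close> is unbounded.  Reflecting each interval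
  matches the upper neighbours with pairs of a lower neighbour and the excess of \<open>g 0\<close>.
\<close>

definition toggle :: "(nat \<Rightarrow> nat) \<Rightarrow> (nat \<Rightarrow> nat) \<Rightarrow> (nat \<Rightarrow> nat) \<Rightarrow> nat \<Rightarrow> nat" where
  "toggle f m k i = min (f i) (m i) + max (f (Suc i)) (m (Suc i)) - k i"

text \<open>Summing the reflections gives all the minima and the maxima from row 1 on. The value
  \<open>g 0\<close> contributes the missing maximum of row 0 and the excess \<open>t\<close>, and a
  minimum plus the matching maximum is \<open>f i + m i\<close>.\<close>

lemma shape_size_toggle:
  assumes "shape f" "shape m" "interlace f g" "interlace m g"
    "k = toggle f m (\<lambda>i. g (Suc i))" "g 0 = max (f 0) (m 0) + t"
  shows "shape_size g + shape_size k = shape_size f + shape_size m + t"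
proof -
  have sg: "shape g" using interlace_shape_above[OF assms(3,1)] .
  obtain n1 where n1: "\<forall>i\<ge>n1. f i = 0" using assms(1) unfolding shape_alt by blast
  obtain n2 where n2: "\<forall>i\<ge>n2. m i = 0" using assms(2) unfolding shape_alt by blast
  obtain n3 where n3: "\<forall>i\<ge>n3. g i = 0" using sg unfolding shape_alt by blast
  note n = n1 n2 n3
  define n where "n = Suc (n1 + n2 + n3)"
  have g: "g i \<ge> f i" "g i \<ge> m i" "g (Suc i) \<le> f i" "g (Suc i) \<le> m i" for i
    using assms(3,4) unfolding interlace_def by blast+
  have eq: "g (Suc i) + k i = min (f i) (m i) + max (f (Suc i)) (m (Suc i))" for i
    unfolding assms(5) toggle_def using g[of i] g[of "Suc i"] by (auto simp: min_def max_def)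
  have k0: "k i = 0" if "i \<ge> n" for i
    using eq[of i] n that by (simp add: n_def)
  have split: "sum h {..<Suc n} = h 0 + (\<Sum>i<n. h (Suc i))" for h :: "nat \<Rightarrow> nat"
    by (rule sum.lessThan_Suc_shift)
  have S: "shape_size g = sum g {..<Suc n}" "shape_size f = sum f {..<n}"
    "shape_size m = sum m {..<n}" "shape_size k = sum k {..<n}"
    using n k0 by (intro shape_size_eq; simp add: n_def)+
  have "shape_size g + shape_size k = g 0 + (\<Sum>i<n. g (Suc i) + k i)"
    unfolding S(1,4) split by (simp add: sum.distrib)
  also have "\<dots> = t + (\<Sum>i<n. min (f i) (m i)) + (max (f 0) (m 0) + (\<Sum>i<n. max (f (Suc i)) (m (Suc i))))"
    unfolding eq assms(6) by (simp add: sum.distrib)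
  also have "\<dots> = t + (\<Sum>i<n. min (f i) (m i)) + (\<Sum>i<Suc n. max (f i) (m i))"
    by (simp only: split)
  \<comment> \<open>Index \<open>n\<close> lies beyond both supports, so the last maximum is
    zero.\<close>
  also have "\<dots> = t + (\<Sum>i<n. min (f i) (m i) + max (f i) (m i))"
    using n by (simp add: n_def sum.distrib)
  also have "(\<Sum>i<n. min (f i) (m i) + max (f i) (m i)) = (\<Sum>i<n. f i + m i)"
    by (intro sum.cong) auto
  also have "\<dots> = shape_size f + shape_size m" unfolding S by (simp add: sum.distrib)
  finally show ?thesis by simp
qed

text \<open>Since \<open>k i\<close> never exceeds the minimum, the truncated subtraction loses
  nothing and the reflection is an involution.\<close>

lemma toggle_invol:
  assumes "\<And>i. k i \<le> f i" "\<And>i. k i \<le> m i"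
  shows "toggle f m (toggle f m k) = k"
proof
  fix i show "toggle f m (toggle f m k) i = k i"
    unfolding toggle_def using assms[of i] by auto
qed

lemma toggle_interlace_below:
  assumes "interlace f g" "interlace m g"
  shows "interlace (toggle f m (\<lambda>i. g (Suc i))) f" "interlace (toggle f m (\<lambda>i. g (Suc i))) m"
proof -
  have g: "g i \<ge> f i" "g i \<ge> m i" "g (Suc i) \<le> f i" "g (Suc i) \<le> m i"
     "g (Suc i) \<ge> f (Suc i)" "g (Suc i) \<ge> m (Suc i)" for i
    using assms unfolding interlace_def by blast+
  have "toggle f m (\<lambda>i. g (Suc i)) i \<le> f i \<and> f (Suc i) \<le> toggle f m (\<lambda>i. g (Suc i)) i
    \<and> toggle f m (\<lambda>i. g (Suc i)) i \<le> m i \<and> m (Suc i) \<le> toggle f m (\<lambda>i. g (Suc i)) i" for i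
    unfolding toggle_def using g[of i] by (auto simp: min_def max_def)
  then show "interlace (toggle f m (\<lambda>i. g (Suc i))) f" "interlace (toggle f m (\<lambda>i. g (Suc i))) m"
    unfolding interlace_def by blast+
qed

text \<open>The toggled values move up by one index, because \<open>g (Suc i)\<close> and
  \<open>k i\<close> range over the same interval; the new entry at 0 exceeds its least admissible
  value by \<open>t\<close>.\<close>

definition toggle_up :: "(nat \<Rightarrow> nat) \<Rightarrow> (nat \<Rightarrow> nat) \<Rightarrow> nat \<Rightarrow> (nat \<Rightarrow> nat) \<Rightarrow> nat \<Rightarrow> nat" where
  "toggle_up f m t k = case_nat (max (f 0) (m 0) + t) (toggle f m k)"

lemma toggle_interlace_above:
  assumes "interlace k f" "interlace k m"
  shows "interlace f (toggle_up f m t k)" "interlace m (toggle_up f m t k)"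
proof -
  have k: "f i \<ge> k i" "m i \<ge> k i" "f (Suc i) \<le> k i" "m (Suc i) \<le> k i" for i
    using assms unfolding interlace_def by blast+
  have "f i \<le> toggle_up f m t k i \<and> m i \<le> toggle_up f m t k i" for i
    unfolding toggle_up_def toggle_def using k[of "i - 1"] by (cases i) (auto simp: min_def max_def)
  moreover have "toggle_up f m t k (Suc i) \<le> f i \<and> toggle_up f m t k (Suc i) \<le> m i" for i
    unfolding toggle_up_def toggle_def using k[of i] by (auto simp: min_def max_def)
  ultimately show "interlace f (toggle_up f m t k)" "interlace m (toggle_up f m t k)"
    unfolding interlace_def by blast+
qed

text \<open>Adding a strip and then removing one is traded for removing first and adding afterwards.
  The end shape \<open>m\<close> is kept fixed by the bijection; \<open>t\<close> is the excess of
  row 0, and the size identity leaves \<open>r - t\<close> cells for the strip from \<open>k\<close>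
  to \<open>m\<close>.\<close>

lemma strips_commute:
  assumes "shape f"
  shows "(\<Sum>g\<in>strips_above r f. \<Sum>m\<in>strips_below g. F m) =
    (\<Sum>t\<le>r. \<Sum>k\<in>strips_below f. \<Sum>m\<in>strips_above (r - t) k. F (m :: nat \<Rightarrow> nat) :: nat)"
proof -
  define A where "A = (SIGMA g:strips_above r f. strips_below g)"
  define B where "B = (SIGMA t:{..r}. SIGMA k:strips_below f. strips_above (r - t) k)"
  have fA: "finite (strips_above r f)" "\<And>g. g \<in> strips_above r f \<Longrightarrow> finite (strips_below g)"
    using assms finite_strips_above finite_strips_below interlace_shape_above
    by (auto simp: strips_above_def)
  have fB: "finite (strips_below f)" "\<And>k t. k \<in> strips_below f \<Longrightarrow> finite (strips_above t k)"
    using assms finite_strips_above finite_strips_below interlace_shape_below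
    by (auto simp: strips_below_def)
  have "(\<Sum>g\<in>strips_above r f. \<Sum>m\<in>strips_below g. F m) = (\<Sum>(g, m)\<in>A. F m)"
    unfolding A_def using fA by (subst sum.Sigma) auto
  also have "\<dots> = (\<Sum>(t, k, m)\<in>B. F m)"
  proof (rule sum.reindex_bij_witness[of _
        "\<lambda>(t, k, m). (toggle_up f m t k, m)"
        "\<lambda>(g, m). (g 0 - max (f 0) (m 0), toggle f m (\<lambda>i. g (Suc i)), m)"])
    fix a assume "a \<in> A"
    then obtain g m where a: "a = (g, m)" and g: "interlace f g" "shape_size g = shape_size f + r"
      and m: "interlace m g" by (auto simp: A_def strips_above_def strips_below_def)
    let ?k = "toggle f m (\<lambda>i. g (Suc i))" and ?t = "g 0 - max (f 0) (m 0)"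
    have sm: "shape m" using assms g m interlace_shape_above interlace_shape_below by blast
    have le: "g i \<ge> f i" "g i \<ge> m i" "g (Suc i) \<le> f i" "g (Suc i) \<le> m i" for i
      using g m unfolding interlace_def by blast+
    have g0: "g 0 = max (f 0) (m 0) + ?t" using le[of 0] by auto
    have sz: "shape_size g + shape_size ?k = shape_size f + shape_size m + ?t"
      by (rule shape_size_toggle[OF assms sm g(1) m refl g0])
    have kint: "interlace ?k f" "interlace ?k m" using toggle_interlace_below g m by blast+
    \<comment> \<open>With \<open>sz\<close>, this inequality gives \<open>?t \<le> r\<close>, so
      that the natural number \<open>r - ?t\<close> is an exact difference.\<close>
    have "shape_size ?k \<le> shape_size m"
    proof -
      obtain n where n: "\<forall>i\<ge>n. m i = 0" using sm unfolding shape_alt by blast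
      have km: "?k i \<le> m i" for i using kint(2) unfolding interlace_def by blast
      have "?k i = 0" if "i \<ge> n" for i using km[of i] n that by simp
      then have "shape_size m = sum m {..<n}" "shape_size ?k = sum ?k {..<n}"
        using n by (intro shape_size_eq; simp)+
      then show ?thesis using km by (simp add: sum_mono)
    qed
    then have tr: "?t \<le> r" "shape_size m = shape_size ?k + (r - ?t)" using sz g(2) by auto
    have "toggle f m ?k = (\<lambda>i. g (Suc i))" using le by (intro toggle_invol)
    then have "toggle_up f m ?t ?k = g"
      using g0 by (auto simp: toggle_up_def fun_eq_iff split: nat.split)
    then show "(case (case a of (g, m) \<Rightarrow> (g 0 - max (f 0) (m 0), toggle f m (\<lambda>i. g (Suc i)), m)) of
      (t, k, m) \<Rightarrow> (toggle_up f m t k, m)) = a" by (simp add: a)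
    show "(case a of (g, m) \<Rightarrow> (g 0 - max (f 0) (m 0), toggle f m (\<lambda>i. g (Suc i)), m)) \<in> B"
      using tr kint by (simp add: a B_def strips_below_def strips_above_def)
  next
    fix b assume "b \<in> B"
    then obtain t k m where b: "b = (t, k, m)" and t: "t \<le> r" and k: "interlace k f"
      and m: "interlace k m" "shape_size m = shape_size k + (r - t)"
      by (auto simp: B_def strips_above_def strips_below_def)
    have sm: "shape m" using assms k m interlace_shape_above interlace_shape_below by blast
    let ?g = "toggle_up f m t k"
    have gint: "interlace f ?g" "interlace m ?g" using toggle_interlace_above k m by blast+
    have "k i \<le> f i" "k i \<le> m i" for i using k m unfolding interlace_def by blast+
    then have kk: "toggle f m (\<lambda>i. ?g (Suc i)) = k"
      by (simp add: toggle_up_def toggle_invol)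
    have g0: "?g 0 = max (f 0) (m 0) + t" by (simp add: toggle_up_def)
    have sz: "shape_size ?g + shape_size k = shape_size f + shape_size m + t"
      by (rule shape_size_toggle[OF assms sm gint kk[symmetric] g0])
    then have "shape_size ?g = shape_size f + r" using m t by auto
    then show "(case b of (t, k, m) \<Rightarrow> (toggle_up f m t k, m)) \<in> A"
      using gint by (simp add: b A_def strips_below_def strips_above_def)
    show "(case (case b of (t, k, m) \<Rightarrow> (toggle_up f m t k, m)) of
       (g, m) \<Rightarrow> (g 0 - max (f 0) (m 0), toggle f m (\<lambda>i. g (Suc i)), m)) = b"
      using kk g0 by (simp add: b)
  qed auto
  also have "\<dots> = (\<Sum>t\<le>r. \<Sum>k\<in>strips_below f. \<Sum>m\<in>strips_above (r - t) k. F m)"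
    unfolding B_def using fB by (subst sum.Sigma | auto)+
  finally show ?thesis .
qed

section \<open>The Pieri rule for the tableau counts\<close>

lemma shape_size_0_iff: "shape f \<Longrightarrow> shape_size f = 0 \<longleftrightarrow> f = (\<lambda>_. 0)"
  by (auto simp: shape_size_def shape_def)

text \<open>A hockey-stick sum. For \<open>k = 0\<close> truncated subtraction makes the term at
  \<open>t = 0\<close> equal to 1 and all others 0, as the empty alphabet requires.\<close>

lemma sum_choose_stars: "(\<Sum>t\<le>r. (k + t - 1) choose t) = (k + r) choose r"
proof (cases k)
  case 0
  have "(\<Sum>t\<le>r. (t - 1) choose t) = (\<Sum>t\<in>{0}. (t - 1) choose t)"
    by (rule sum.mono_neutral_right) (auto simp: binomial_eq_0)
  then show ?thesis using 0 by simp
next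
  case (Suc n)
  then show ?thesis using sum_choose_lower[of n r] by simp
qed

text \<open>The factor counts multisets of size \<open>r\<close> from \<open>k\<close> letters. In
  the induction on \<open>k\<close>, \<open>strips_commute\<close> moves the added strip past the
  strip of the largest letter; the excess \<open>t\<close> is the multiplicity of that letter in the
  multiset.\<close>

lemma num_ssyt_pieri:
  assumes "shape f"
  shows "(\<Sum>g\<in>strips_above r f. num_ssyt k g) = ((k + r - 1) choose r) * num_ssyt k f"
  using assms
proof (induction k arbitrary: f r)
  case (0 f r)
  have fin: "finite (strips_above r f)" using 0 finite_strips_above by blast
  have z: "shape_size (\<lambda>_. 0) = 0" by (simp add: shape_size_def)
  have mem: "(\<lambda>_. 0) \<in> strips_above r f \<longleftrightarrow> f = (\<lambda>_. 0) \<and> r = 0"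
    using 0 shape_size_0_iff[OF 0] by (auto simp: strips_above_def z interlace_def)
  have "(\<Sum>g\<in>strips_above r f. num_ssyt 0 g) = (if (\<lambda>_. 0) \<in> strips_above r f then 1 else 0)"
    using fin by (simp add: sum.delta)
  also have "\<dots> = ((0 + r - 1) choose r) * num_ssyt 0 f"
    unfolding mem by (cases r) (auto simp: binomial_eq_0)
  finally show ?case .
next
  case (Suc k f r)
  have "(\<Sum>g\<in>strips_above r f. num_ssyt (Suc k) g) =
      (\<Sum>t\<le>r. \<Sum>m\<in>strips_below f. \<Sum>g\<in>strips_above (r - t) m. num_ssyt k g)"
    by (simp add: strips_commute[OF Suc.prems])
  also have "\<dots> = (\<Sum>t\<le>r. \<Sum>m\<in>strips_below f. ((k + (r - t) - 1) choose (r - t)) * num_ssyt k m)"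
    using Suc.IH interlace_shape_below[OF _ Suc.prems] by (simp add: strips_below_def)
  also have "\<dots> = (\<Sum>t\<le>r. (k + (r - t) - 1) choose (r - t)) * num_ssyt (Suc k) f"
    unfolding num_ssyt.simps sum_product by (rule refl)
  also have "(\<Sum>t\<le>r. (k + (r - t) - 1) choose (r - t)) = (\<Sum>t\<le>r. (k + t - 1) choose t)"
    by (rule sum.reindex_bij_witness[of _ "\<lambda>t. r - t" "\<lambda>t. r - t"]) auto
  finally show ?case unfolding sum_choose_stars by simp
qed

section \<open>Standard tableaux and their largest entry\<close>

definition cells :: "(nat \<Rightarrow> nat) \<Rightarrow> (nat \<times> nat) set" where
  "cells f = {(i, j). j < f i}"

definition syt :: "(nat \<Rightarrow> nat) \<Rightarrow> (nat \<times> nat \<Rightarrow> nat) set" where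
  "syt f = {T \<in> extensional (cells f).
     bij_betw T (cells f) {1..shape_size f} \<and>
     (\<forall>i j j'. (i, j) \<in> cells f \<and> (i, j') \<in> cells f \<and> j < j' \<longrightarrow> T (i, j) < T (i, j')) \<and>
     (\<forall>i i' j. (i, j) \<in> cells f \<and> (i', j) \<in> cells f \<and> i < i' \<longrightarrow> T (i, j) < T (i', j))}"

definition row_of :: "(nat \<Rightarrow> nat) \<Rightarrow> (nat \<times> nat \<Rightarrow> nat) \<Rightarrow> nat \<Rightarrow> nat" where
  "row_of f T k = fst (inv_into (cells f) T k)"

definition descents :: "(nat \<Rightarrow> nat) \<Rightarrow> (nat \<times> nat \<Rightarrow> nat) \<Rightarrow> nat set" where
  "descents f T = {k \<in> {1..<shape_size f}. row_of f T k < row_of f T (Suc k)}"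

definition corners :: "(nat \<Rightarrow> nat) \<Rightarrow> nat set" where
  "corners f = {c. f (Suc c) < f c}"

definition remove_cell :: "nat \<Rightarrow> (nat \<Rightarrow> nat) \<Rightarrow> nat \<Rightarrow> nat" where
  "remove_cell c f = f(c := f c - 1)"

lemma cells_iff [simp]: "(i, j) \<in> cells f \<longleftrightarrow> j < f i"
  by (simp add: cells_def)

lemma finite_corners: "shape f \<Longrightarrow> finite (corners f)"
  unfolding shape_def corners_def by (auto elim: rev_finite_subset)

lemma cells_Sigma: "cells f = (SIGMA i:{i. f i \<noteq> 0}. {..<f i})"
  by (auto simp: cells_def)

lemma finite_cells: "shape f \<Longrightarrow> finite (cells f)"
  unfolding cells_Sigma shape_def by auto

lemma card_cells: "shape f \<Longrightarrow> card (cells f) = shape_size f"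
  unfolding cells_Sigma shape_def shape_size_def by (subst card_SigmaI) auto

lemma finite_syt:
  assumes "shape f" shows "finite (syt f)"
proof (rule finite_subset)
  show "syt f \<subseteq> cells f \<rightarrow>\<^sub>E {1..shape_size f}"
    by (auto simp: syt_def PiE_def dest: bij_betwE)
  show "finite (cells f \<rightarrow>\<^sub>E {1..shape_size f})"
    using finite_cells[OF assms] by (intro finite_PiE) auto
qed

lemma corner_pos: "c \<in> corners f \<Longrightarrow> 0 < f c"
  unfolding corners_def by auto

section \<open>Removing the corner that holds the largest entry\<close>

lemma shape_remove_cell:
  assumes "shape f" "c \<in> corners f"
  shows "shape (remove_cell c f)"
proof -
  obtain n where "\<forall>i\<ge>n. f i = 0" using assms unfolding shape_alt by blast
  then have "\<forall>i\<ge>n. remove_cell c f i = 0" by (simp add: remove_cell_def)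
  moreover have "remove_cell c f (Suc i) \<le> remove_cell c f i" for i
  proof -
    have "f (Suc i) \<le> f i" using assms(1) unfolding shape_alt by blast
    then show ?thesis using assms(2) by (auto simp: remove_cell_def corners_def)
  qed
  ultimately show ?thesis unfolding shape_alt by blast
qed

lemma cells_remove_cell:
  assumes "c \<in> corners f"
  shows "cells f = insert (c, f c - 1) (cells (remove_cell c f))"
    "(c, f c - 1) \<notin> cells (remove_cell c f)"
  using corner_pos[OF assms] by (auto simp: remove_cell_def split: if_splits)

lemma shape_size_remove_cell:
  assumes "shape f" "c \<in> corners f"
  shows "shape_size f = Suc (shape_size (remove_cell c f))"
proof -
  have "card (cells f) = Suc (card (cells (remove_cell c f)))"
    using cells_remove_cell[OF assms(2)] finite_cells[OF shape_remove_cell[OF assms]] by simp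
  then show ?thesis by (simp add: card_cells assms shape_remove_cell)
qed

lemma sytD:
  assumes "T \<in> syt f"
  shows "T \<in> extensional (cells f)" "bij_betw T (cells f) {1..shape_size f}"
    "\<And>i j j'. j < j' \<Longrightarrow> j' < f i \<Longrightarrow> T (i, j) < T (i, j')"
    "\<And>i i' j. i < i' \<Longrightarrow> j < f i \<Longrightarrow> j < f i' \<Longrightarrow> T (i, j) < T (i', j)"
  using assms unfolding syt_def by auto

lemma syt_le: "T \<in> syt f \<Longrightarrow> p \<in> cells f \<Longrightarrow> T p \<le> shape_size f"
  using bij_betwE[OF sytD(2)] by fastforce

lemma syt_obtain:
  assumes "T \<in> syt f" "k \<in> {1..shape_size f}"
  obtains p where "p \<in> cells f" "T p = k"
  using bij_betw_imp_surj_on[OF sytD(2)[OF assms(1)]] assms(2) by (metis imageE)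

lemma row_of_eq: "T \<in> syt f \<Longrightarrow> p \<in> cells f \<Longrightarrow> row_of f T (T p) = fst p"
  unfolding row_of_def by (simp add: inv_into_f_f bij_betw_imp_inj_on[OF sytD(2)])

text \<open>A cell to the right of the largest entry or below it would have to carry a still larger
  one.\<close>

lemma syt_max_corner:
  assumes "shape f" "T \<in> syt f" "(c, j) \<in> cells f" "T (c, j) = shape_size f"
  shows "c \<in> corners f" "j = f c - 1"
proof -
  show j: "j = f c - 1"
  proof (rule ccontr)
    assume "j \<noteq> f c - 1"
    then have "Suc j < f c" using assms(3) by auto
    then show False using sytD(3)[OF assms(2), of j "Suc j" c] syt_le[OF assms(2), of "(c, Suc j)"]
        assms(4) by auto
  qed
  show "c \<in> corners f"
  proof (rule ccontr)
    assume "c \<notin> corners f"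
    then have "j < f (Suc c)" using j assms(3) by (auto simp: corners_def)
    then show False using sytD(4)[OF assms(2), of c "Suc c" j] syt_le[OF assms(2), of "(Suc c, j)"]
        assms(3,4) by auto
  qed
qed

lemma syt_restrict:
  assumes "shape f" "c \<in> corners f" "T \<in> syt f" "T (c, f c - 1) = shape_size f"
  shows "restrict T (cells (remove_cell c f)) \<in> syt (remove_cell c f)"
proof -
  let ?g = "remove_cell c f"
  have "bij_betw T (cells f - {(c, f c - 1)}) ({1..shape_size f} - {T (c, f c - 1)})"
    using sytD(2)[OF assms(3)] corner_pos[OF assms(2)]
    by (simp add: bij_betw_def inj_on_image_set_diff[of T "cells f"] inj_on_diff)
  moreover have "cells f - {(c, f c - 1)} = cells ?g"
    using cells_remove_cell[OF assms(2)] by auto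
  moreover have "{1..shape_size f} - {T (c, f c - 1)} = {1..shape_size ?g}"
    using assms(4) shape_size_remove_cell[OF assms(1,2)] by auto
  ultimately have "bij_betw T (cells ?g) {1..shape_size ?g}" by simp
  then have "bij_betw (restrict T (cells ?g)) (cells ?g) {1..shape_size ?g}"
    by (simp cong: bij_betw_cong)
  moreover have "j < f i" if "j < ?g i" for i j
    using that by (auto simp: remove_cell_def split: if_splits)
  ultimately show ?thesis using sytD(3,4)[OF assms(3)] unfolding syt_def by auto
qed

lemma syt_extend:
  assumes "shape f" "c \<in> corners f" "T \<in> syt (remove_cell c f)"
  shows "T((c, f c - 1) := shape_size f) \<in> syt f"
proof -
  let ?g = "remove_cell c f" and ?p = "(c, f c - 1)"
  let ?T = "T(?p := shape_size f)"
  have S: "shape_size f = Suc (shape_size ?g)" using shape_size_remove_cell[OF assms(1,2)] .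
  note C = cells_remove_cell[OF assms(2)]
  have "bij_betw ?T (cells ?g) {1..shape_size ?g}"
    using sytD(2)[OF assms(3)] C(2) by (subst bij_betw_cong[of _ _ T]) auto
  then have bij: "bij_betw ?T (cells f) {1..shape_size f}"
    using notIn_Un_bij_betw[of ?p "cells ?g" ?T "{1..shape_size ?g}"] C S
    by (simp add: atLeastAtMostSuc_conv)
  have le: "T p < shape_size f" if "p \<in> cells ?g" for p
    using syt_le[OF assms(3) that] S by simp
  have mono: "?T p < ?T q"
    if "p \<in> cells f" "q \<in> cells f" "p \<noteq> ?p" "q \<in> cells ?g \<Longrightarrow> T p < T q" for p q
  proof (cases "q = ?p")
    case True
    then show ?thesis using le[of p] that C by auto
  next
    case False
    then show ?thesis using that C by auto
  qed
  have anti: "f i' \<le> f (Suc i)" if "i < i'" for i i'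
    using that shape_antimono[OF assms(1), of "Suc i" i'] by auto
  have "?T (i, j) < ?T (i, j')" if "j < j'" "j' < f i" for i j j'
    using that sytD(3)[OF assms(3), of j j' i] by (intro mono) auto
  moreover have "?T (i, j) < ?T (i', j)" if "i < i'" "j < f i" "j < f i'" for i i' j
  proof (intro mono)
    \<comment> \<open>The cell \<open>(i', j)\<close> lies below \<open>(i, j)\<close>, whereas
      nothing lies below a corner: here \<open>j < f (Suc i)\<close>, but
      \<open>f (Suc c) < f c\<close>.\<close>
    show "(i, j) \<noteq> ?p" using that anti[of i i'] assms(2) by (auto simp: corners_def)
    then have "(i, j) \<in> cells ?g" using that C(1) by (metis cells_iff insert_iff)
    then show "T (i, j) < T (i', j)" if "(i', j) \<in> cells ?g"
      using that \<open>i < i'\<close> sytD(4)[OF assms(3), of i i' j] by auto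
  qed (use that in auto)
  moreover have "?T \<in> extensional (cells f)"
    using sytD(1)[OF assms(3)] C by (auto simp: extensional_def)
  ultimately show ?thesis using bij unfolding syt_def by auto
qed

lemma row_of_max:
  assumes "shape f" "c \<in> corners f" "T \<in> syt f" "T (c, f c - 1) = shape_size f"
  shows "row_of f T (shape_size f) = c"
  using row_of_eq[OF assms(3), of "(c, f c - 1)"] assms(4) corner_pos[OF assms(2)] by simp

text \<open>Deleting the largest entry \<open>Suc n\<close> keeps the rows of all other entries, so
  only the descent at \<open>n\<close> can be lost. It is present exactly if \<open>n\<close> is an
  entry and its row is above \<open>c\<close>.\<close>

lemma card_descents_restrict:
  assumes "shape f" "c \<in> corners f" "T \<in> syt f" "T (c, f c - 1) = shape_size f"
    and "shape_size f = Suc n"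
  defines "T' \<equiv> restrict T (cells (remove_cell c f))"
  shows "card (descents f T) = card (descents (remove_cell c f) T') +
    (if 0 < n \<and> row_of (remove_cell c f) T' n < c then 1 else 0)"
proof -
  let ?g = "remove_cell c f"
  have T': "T' \<in> syt ?g" unfolding T'_def by (rule syt_restrict[OF assms(1-4)])
  have n: "shape_size ?g = n" using shape_size_remove_cell[OF assms(1,2)] assms(5) by simp
  have row: "row_of f T k = row_of ?g T' k" if k: "k \<in> {1..n}" for k
  proof -
    obtain p where p: "p \<in> cells ?g" "T' p = k"
      by (rule syt_obtain[OF T', of k]) (use k n in simp_all)
    then have Tp: "T p = k" "p \<in> cells f"
      unfolding T'_def by (simp_all add: cells_remove_cell(1)[OF assms(2)] del: cells_iff)
    show ?thesis using row_of_eq[OF assms(3) Tp(2)] row_of_eq[OF T' p(1)] Tp(1) p(2) by simp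
  qed
  have last: "row_of f T (Suc n) = c" using row_of_max[OF assms(1-4)] assms(5) by simp
  have "descents f T = descents ?g T' \<union> {k. k = n \<and> 0 < n \<and> row_of ?g T' n < c}"
  proof (intro set_eqI)
    fix k
    consider "k < 1" | "1 \<le> k" "k < n" | "k = n" "1 \<le> k" | "k > n" by linarith
    then show "k \<in> descents f T \<longleftrightarrow> k \<in> descents ?g T' \<union> {k. k = n \<and> 0 < n \<and> row_of ?g T' n < c}"
    proof cases
      case 2
      then show ?thesis using row[of k] row[of "Suc k"] by (simp add: descents_def n assms(5))
    next
      case 3
      then show ?thesis using row[of k] last by (simp add: descents_def n assms(5))
    qed (auto simp: descents_def n assms(5))
  qed
  moreover have "n \<notin> descents ?g T'" by (simp add: descents_def n)
  moreover have "finite (descents ?g T')" by (simp add: descents_def)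
  ultimately show ?thesis by auto
qed

text \<open>A tableau corresponds to the row of its largest entry together with its restriction. The
  summand \<open>F\<close> sees both that row and the descent number, because the recursion has to
  track both.\<close>

lemma sum_syt_by_corner:
  fixes F :: "nat \<Rightarrow> nat \<Rightarrow> 'a :: comm_monoid_add"
  assumes "shape f" "shape_size f = Suc n"
  shows "(\<Sum>T\<in>syt f. F (row_of f T (Suc n)) (card (descents f T))) =
    (\<Sum>c\<in>corners f. \<Sum>T\<in>syt (remove_cell c f).
      F c (card (descents (remove_cell c f) T) +
        (if 0 < n \<and> row_of (remove_cell c f) T n < c then 1 else 0)))"
proof -
  define G where "G = (\<lambda>(c, T). F c (card (descents (remove_cell c f) T) +
        (if 0 < n \<and> row_of (remove_cell c f) T n < c then 1 else 0)))"
  let ?S = "SIGMA c:corners f. syt (remove_cell c f)"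
  have corner: "row_of f T (Suc n) \<in> corners f \<and>
      T (row_of f T (Suc n), f (row_of f T (Suc n)) - 1) = shape_size f" if T: "T \<in> syt f" for T
  proof -
    obtain c j where p: "(c, j) \<in> cells f" "T (c, j) = shape_size f"
      using syt_obtain[OF T, of "shape_size f"] assms(2) by (metis atLeastAtMost_iff le_refl
          le_add1 plus_1_eq_Suc surj_pair)
    then have "row_of f T (Suc n) = c" using row_of_eq[OF T p(1)] assms(2) by simp
    then show ?thesis using syt_max_corner[OF assms(1) T p] p by simp
  qed
  have "(\<Sum>T\<in>syt f. F (row_of f T (Suc n)) (card (descents f T))) = sum G ?S"
  proof (rule sum.reindex_bij_witness[of _
        "\<lambda>(c, T). T((c, f c - 1) := shape_size f)"
        "\<lambda>T. (row_of f T (Suc n), restrict T (cells (remove_cell (row_of f T (Suc n)) f)))"])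
    fix T assume T: "T \<in> syt f"
    define c where "c = row_of f T (Suc n)"
    have c: "c \<in> corners f" "T (c, f c - 1) = shape_size f" using corner[OF T] by (auto simp: c_def)
    have "(restrict T (cells (remove_cell c f)))((c, f c - 1) := shape_size f) = T"
    proof
      fix p show "((restrict T (cells (remove_cell c f)))((c, f c - 1) := shape_size f)) p = T p"
        using c cells_remove_cell(1)[OF c(1)] extensional_arb[OF sytD(1)[OF T], of p]
        by (cases "p \<in> cells f") (auto simp: restrict_apply simp del: cells_iff)
    qed
    then show "(case (row_of f T (Suc n), restrict T (cells (remove_cell (row_of f T (Suc n)) f))) of
        (c, T) \<Rightarrow> T((c, f c - 1) := shape_size f)) = T" by (simp add: c_def)
    show "(row_of f T (Suc n), restrict T (cells (remove_cell (row_of f T (Suc n)) f))) \<in> ?S"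
      using syt_restrict[OF assms(1) c(1) T c(2)] c(1) by (simp add: c_def)
    show "G (row_of f T (Suc n), restrict T (cells (remove_cell (row_of f T (Suc n)) f))) =
        F (row_of f T (Suc n)) (card (descents f T))"
      using card_descents_restrict[OF assms(1) c(1) T c(2) assms(2)] by (simp add: G_def c_def)
  next
    fix b assume "b \<in> ?S"
    then obtain c T where b: "b = (c, T)" and c: "c \<in> corners f" and T: "T \<in> syt (remove_cell c f)"
      by auto
    let ?T = "T((c, f c - 1) := shape_size f)"
    have T': "?T \<in> syt f" by (rule syt_extend[OF assms(1) c T])
    have row: "row_of f ?T (Suc n) = c" using row_of_max[OF assms(1) c T'] assms(2) by simp
    have "restrict ?T (cells (remove_cell c f)) = T"
    proof
      fix p show "restrict ?T (cells (remove_cell c f)) p = T p"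
        using cells_remove_cell(2)[OF c] extensional_arb[OF sytD(1)[OF T], of p]
        by (auto simp: restrict_apply simp del: cells_iff)
    qed
    then show "(row_of f (case b of (c, T) \<Rightarrow> T((c, f c - 1) := shape_size f)) (Suc n),
        restrict (case b of (c, T) \<Rightarrow> T((c, f c - 1) := shape_size f))
         (cells (remove_cell (row_of f (case b of (c, T) \<Rightarrow> T((c, f c - 1) := shape_size f)) (Suc n)) f)))
        = b" unfolding b prod.case row by (simp only:)
    show "(case b of (c, T) \<Rightarrow> T((c, f c - 1) := shape_size f)) \<in> syt f" using T' by (simp add: b)
  qed
  also have "\<dots> = (\<Sum>c\<in>corners f. \<Sum>T\<in>syt (remove_cell c f). G (c, T))"
    using finite_corners finite_syt shape_remove_cell assms(1) by (subst sum.Sigma) auto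
  finally show ?thesis by (simp add: G_def)
qed

section \<open>Counting semistandard tableaux by descents\<close>

definition strips_below_from :: "nat \<Rightarrow> (nat \<Rightarrow> nat) \<Rightarrow> (nat \<Rightarrow> nat) set" where
  "strips_below_from i f = {m \<in> strips_below f. \<forall>a<i. m a = f a}"

lemma strips_below_from_0: "strips_below_from 0 f = strips_below f"
  by (simp add: strips_below_from_def)

lemma finite_strips_below_from: "shape f \<Longrightarrow> finite (strips_below_from i f)"
  by (simp add: strips_below_from_def finite_strips_below)

text \<open>If rows above \<open>c\<close> are untouched, removing the corner cell of row
  \<open>c\<close> first amounts to requiring that the strip meet row \<open>c\<close>.\<close>

lemma strips_below_from_remove_cell:
  assumes "shape f" "c \<in> corners f"
  shows "strips_below_from c (remove_cell c f) = {m \<in> strips_below_from c f. m c < f c}"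
proof (intro set_eqI iffI)
  fix m assume "m \<in> strips_below_from c (remove_cell c f)"
  then have m: "\<And>i. m i \<le> remove_cell c f i" "\<And>i. remove_cell c f (Suc i) \<le> m i"
    "\<And>a. a < c \<Longrightarrow> m a = f a"
    by (auto simp: strips_below_from_def strips_below_def interlace_def remove_cell_def)
  have "m i \<le> f i" for i using m(1)[of i] by (auto simp: remove_cell_def split: if_splits)
  moreover have "f (Suc i) \<le> m i" for i
  proof (cases "Suc i = c")
    case True
    then show ?thesis using m(3)[of i] assms(1) by (auto simp: shape_alt)
  next
    case False
    then show ?thesis using m(2)[of i] by (simp add: remove_cell_def)
  qed
  moreover have "m c < f c"
    using m(1)[of c] corner_pos[OF assms(2)] by (simp add: remove_cell_def)
  ultimately show "m \<in> {m \<in> strips_below_from c f. m c < f c}"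
    using m(3) by (simp add: strips_below_from_def strips_below_def interlace_def)
next
  fix m assume "m \<in> {m \<in> strips_below_from c f. m c < f c}"
  then have m: "\<And>i. m i \<le> f i" "\<And>i. f (Suc i) \<le> m i" "\<And>a. a < c \<Longrightarrow> m a = f a" "m c < f c"
    by (auto simp: strips_below_from_def strips_below_def interlace_def)
  have "m i \<le> remove_cell c f i" for i using m(1)[of i] m(4) by (cases "i = c") (auto simp: remove_cell_def)
  moreover have "remove_cell c f (Suc i) \<le> m i" for i
    using m(2)[of i] by (auto simp: remove_cell_def)
  ultimately show "m \<in> strips_below_from c (remove_cell c f)"
    using m(3) by (simp add: strips_below_from_def strips_below_def interlace_def remove_cell_def)
qed

text \<open>The corner \<open>c\<close> is the end of the topmost row that meets the strip.\<close>

lemma sum_strips_below_from: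
  fixes F :: "(nat \<Rightarrow> nat) \<Rightarrow> 'a :: comm_monoid_add"
  assumes "shape f"
  shows "(\<Sum>m\<in>strips_below_from i f. F m) =
    F f + (\<Sum>c | c \<in> corners f \<and> i \<le> c. \<Sum>m\<in>strips_below_from c (remove_cell c f). F m)"
proof -
  let ?C = "{c. c \<in> corners f \<and> i \<le> c}"
  let ?S = "\<lambda>c. strips_below_from c (remove_cell c f)"
  have mem: "m \<in> ?S c \<longleftrightarrow> m \<in> strips_below_from c f \<and> m c < f c" if "c \<in> corners f" for c m
    using strips_below_from_remove_cell[OF assms that] by simp
  have "strips_below_from i f = insert f (\<Union>c\<in>?C. ?S c)"
  proof (intro set_eqI iffI)
    fix m assume "m \<in> strips_below_from i f"
    then have m: "\<And>a. m a \<le> f a" "\<And>a. f (Suc a) \<le> m a" "\<And>a. a < i \<Longrightarrow> m a = f a"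
      by (auto simp: strips_below_from_def strips_below_def interlace_def)
    show "m \<in> insert f (\<Union>c\<in>?C. ?S c)"
    proof (cases "m = f")
      case False
      then obtain a where "m a \<noteq> f a" by auto
      define c where "c = (LEAST a. m a \<noteq> f a)"
      have c: "m c \<noteq> f c" unfolding c_def by (rule LeastI) fact
      have lt: "m a = f a" if "a < c" for a using not_less_Least that unfolding c_def by blast
      have "m c < f c" using c m(1)[of c] by simp
      moreover from this have "c \<in> corners f" using m(2)[of c] by (simp add: corners_def)
      moreover have "i \<le> c" using m(3) c by (meson not_le)
      moreover have "m \<in> strips_below_from c f"
        using m(1,2) lt by (simp add: strips_below_from_def strips_below_def interlace_def)
      ultimately have "c \<in> ?C" "m \<in> ?S c" using mem by simp_all
      then show ?thesis by blast
    qed simp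
  next
    fix m assume "m \<in> insert f (\<Union>c\<in>?C. ?S c)"
    then consider "m = f" | c where "c \<in> corners f" "i \<le> c" "m \<in> ?S c" by blast
    then show "m \<in> strips_below_from i f"
    proof cases
      case 1
      then show ?thesis using assms by (simp add: strips_below_from_def strips_below_def interlace_refl)
    next
      case 2
      then have "m \<in> strips_below_from c f" using mem by blast
      then show ?thesis using 2(2) by (simp add: strips_below_from_def)
    qed
  qed
  moreover have "f \<notin> (\<Union>c\<in>?C. ?S c)" by (auto simp: mem)
  moreover have fin: "finite ?C" using finite_corners[OF assms] by simp
  moreover have finS: "\<forall>c\<in>?C. finite (?S c)"
    using finite_strips_below_from shape_remove_cell assms by blast
  \<comment> \<open>For \<open>c < d\<close>, members of \<open>?S c\<close> differ from
    \<open>f\<close> in row \<open>c\<close>, while members of \<open>?S d\<close> agree with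
    \<open>f\<close> there.\<close>
  moreover have "?S c \<inter> ?S d = {}" if "c \<in> ?C" "d \<in> ?C" "c \<noteq> d" for c d
  proof -
    have "False" if "c < d" "m \<in> ?S c" "m \<in> ?S d" "c \<in> ?C" "d \<in> ?C" for c d m
    proof -
      have "m c < f c" "m \<in> strips_below_from d f" using that mem by blast+
      then show False using that(1) by (simp add: strips_below_from_def)
    qed
    then show ?thesis using that by (meson disjoint_iff linorder_neqE_nat)
  qed
  ultimately show ?thesis
    by (simp add: sum.UNION_disjoint)
qed

lemma num_ssyt_empty: "num_ssyt k (\<lambda>_. 0) = 1"
proof (induction k)
  case (Suc k)
  have "strips_below (\<lambda>_. 0) = {\<lambda>_. 0}" by (auto simp: strips_below_def interlace_def)
  then show ?case using Suc by simp
qed simp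

lemma syt_empty: "syt (\<lambda>_. 0) = {\<lambda>_. undefined}"
  by (auto simp: syt_def cells_def shape_size_def extensional_def bij_betw_def)

lemma card_descents_le: "card (descents f T) \<le> shape_size f - 1"
proof -
  have "card (descents f T) \<le> card {1..<shape_size f}"
    unfolding descents_def by (intro card_mono) auto
  then show ?thesis by simp
qed

text \<open>
  The row bound \<open>i\<close> makes the induction work: the right-hand side counts a descent at \<open>N\<close> as if
  the next entry \<open>N + 1\<close> were placed in row \<open>i\<close>.
\<close>

lemma sum_num_ssyt_from:
  assumes "shape f" "shape_size f = N"
  shows "(\<Sum>m\<in>strips_below_from i f. num_ssyt k m) =
    (\<Sum>T\<in>syt f. (N + k - card (descents f T) -
      (if 0 < N \<and> row_of f T N < i then 1 else 0)) choose N)"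
  using assms
proof (induction N arbitrary: f i k)
  case 0
  then have f: "f = (\<lambda>_. 0)" by (simp add: shape_size_0_iff)
  have "strips_below_from i f = {f}"
    by (auto simp: f strips_below_from_def strips_below_def interlace_def)
  then show ?case by (simp add: f num_ssyt_empty syt_empty)
next
  case (Suc n)
  note f = Suc.prems
  define e where "e = (\<lambda>c T. card (descents (remove_cell c f) T) +
    (if 0 < n \<and> row_of (remove_cell c f) T n < c then 1 else 0))"
  define B where "B = (\<lambda>k c. \<Sum>T\<in>syt (remove_cell c f). (n + k - e c T) choose n)"
  \<comment> \<open>\<open>Z k\<close> is the intended closed form of \<open>num_ssyt k f\<close>,
    sorted by the corner that holds the largest entry.\<close>
  define Z where "Z = (\<lambda>k. \<Sum>c\<in>corners f. \<Sum>T\<in>syt (remove_cell c f). (n + k - e c T) choose Suc n)"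
  have size: "shape_size (remove_cell c f) = n" if "c \<in> corners f" for c
    using shape_size_remove_cell[OF f(1) that] f(2) by simp
  have e: "e c T \<le> n" if "c \<in> corners f" for c T
    using card_descents_le[of "remove_cell c f" T] by (cases n) (auto simp: e_def size[OF that])
  have fin: "finite (corners f)" using finite_corners f(1) by blast
  \<comment> \<open>Either the strip is empty or \<open>c\<close> is its topmost row. In the latter
    case the induction hypothesis applies to the smaller shape with row bound \<open>c\<close>,
    which is why the bound must be arbitrary there.\<close>
  have A: "(\<Sum>m\<in>strips_below_from i f. num_ssyt k m) =
      num_ssyt k f + (\<Sum>c | c \<in> corners f \<and> i \<le> c. B k c)" for i k
    unfolding sum_strips_below_from[OF f(1)] B_def
    by (intro arg_cong2[of _ _ _ _ "(+)"] refl sum.cong)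
      (simp add: Suc.IH shape_remove_cell[OF f(1)] size e_def)
  \<comment> \<open>Induction on \<open>k\<close>: both sides vanish at 0, since \<open>f\<close> is
    nonempty and each upper index is at most \<open>n\<close>; the step is \<open>A\<close> with
    bound 0 followed by Pascal's rule.\<close>
  have Z: "num_ssyt k f = Z k" for k
  proof (induction k)
    case 0
    have "f \<noteq> (\<lambda>_. 0)" using f shape_size_0_iff by fastforce
    then show ?case by (simp add: Z_def binomial_eq_0)
  next
    case (Suc k)
    have "num_ssyt (Suc k) f = Z k + (\<Sum>c\<in>corners f. B k c)"
      using A[of k 0] Suc by (simp add: strips_below_from_0)
    also have "\<dots> = (\<Sum>c\<in>corners f. \<Sum>T\<in>syt (remove_cell c f). Suc (n + k - e c T) choose Suc n)"
      by (simp add: Z_def B_def sum.distrib add.commute)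
    also have "\<dots> = Z (Suc k)" unfolding Z_def
      by (intro sum.cong refl arg_cong2[of _ _ _ _ binomial]) (simp add: Suc_diff_le e trans_le_add1)
    finally show ?case .
  qed
  have "(\<Sum>T\<in>syt f. (Suc n + k - card (descents f T) -
      (if 0 < Suc n \<and> row_of f T (Suc n) < i then 1 else 0)) choose Suc n) =
      (\<Sum>c\<in>corners f. \<Sum>T\<in>syt (remove_cell c f).
        (Suc n + k - e c T - (if 0 < Suc n \<and> c < i then 1 else 0)) choose Suc n)"
    unfolding e_def
    by (rule sum_syt_by_corner[OF f, of "\<lambda>c d. (Suc n + k - d - (if 0 < Suc n \<and> c < i then 1 else 0)) choose Suc n"])
  \<comment> \<open>For \<open>c < i\<close> the correction 1 cancels the successor in the upper
    index; for \<open>i \<le> c\<close> the successor remains and Pascal's rule splits the binomial.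
    The bound \<open>e c T \<le> n\<close> keeps the subtraction exact.\<close>
  also have "\<dots> = (\<Sum>c\<in>corners f. \<Sum>T\<in>syt (remove_cell c f).
      ((n + k - e c T) choose Suc n) + (if i \<le> c then (n + k - e c T) choose n else 0))"
  proof (intro sum.cong refl)
    fix c T assume "c \<in> corners f"
    then have "Suc n + k - e c T = Suc (n + k - e c T)" using e[of c T] by simp
    then show "(Suc n + k - e c T - (if 0 < Suc n \<and> c < i then 1 else 0)) choose Suc n =
      ((n + k - e c T) choose Suc n) + (if i \<le> c then (n + k - e c T) choose n else 0)" by simp
  qed
  also have "\<dots> = Z k + (\<Sum>c\<in>corners f. if i \<le> c then B k c else 0)"
    unfolding Z_def B_def sum.distrib by (intro arg_cong2[of _ _ _ _ "(+)"] refl sum.cong) simp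
  also have "\<dots> = num_ssyt k f + (\<Sum>c | c \<in> corners f \<and> i \<le> c. B k c)"
    unfolding Z using fin by (simp add: sum.inter_filter)
  finally show ?case unfolding A by simp
qed

lemma num_ssyt_eq_sum_syt:
  assumes "shape f"
  shows "num_ssyt (Suc k) f =
    (\<Sum>T\<in>syt f. (shape_size f + k - card (descents f T)) choose shape_size f)"
  using sum_num_ssyt_from[OF assms refl, of k 0] by (simp add: strips_below_from_0)

section \<open>The operators in the coordinates \<open>x\<close> and \<open>z = y - x\<close>\<close>

lemma dx_add: "dx (p + q) = dx p + dx q"
  by (rule poly_eqI) (simp add: dx_def coeff_map_poly pderiv_add)

lemma pderiv_sum: "pderiv (sum f A) = (\<Sum>i\<in>A. pderiv (f i))"
  by (induction A rule: infinite_finite_induct) (simp_all add: pderiv_add)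

text \<open>Since \<open>dx\<close> acts on the coefficients in \<open>x\<close>, the Leibniz rule
  is applied inside the convolution formula for the coefficients of a product.\<close>

lemma dx_mult: "dx (p * q) = dx p * q + p * dx q"
proof (rule poly_eqI)
  fix n
  have *: "pderiv (a * b) = pderiv a * b + a * pderiv b" for a b :: "rat poly"
    by (simp add: pderiv_mult)
  have "coeff (dx (p * q)) n = (\<Sum>i\<le>n. pderiv (coeff p i * coeff q (n - i)))"
    by (simp add: dx_def coeff_map_poly coeff_mult pderiv_sum)
  also have "\<dots> = coeff (dx p * q + p * dx q) n"
    by (simp add: dx_def coeff_map_poly coeff_mult * sum.distrib)
  finally show "coeff (dx (p * q)) n = coeff (dx p * q + p * dx q) n" .
qed

lemma diffD_add: "diffD (p + q) = diffD p + diffD q"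
  by (simp add: diffD_def dx_add dy_def pderiv_add)

lemma diffD_mult: "diffD (p * q) = diffD p * q + p * diffD q"
  by (simp add: diffD_def dx_mult dy_def pderiv_mult algebra_simps)

lemma diffD_0 [simp]: "diffD 0 = 0"
  by (simp add: diffD_def dx_def dy_def)

lemma diffD_1 [simp]: "diffD 1 = 0"
  using diffD_mult[of 1 1] by simp

lemma diffD_of_nat [simp]: "diffD (of_nat n) = 0"
  by (induction n) (simp_all add: diffD_add)

text \<open>As \<open>D\<close> kills this element and sends \<open>x\<close> to 1, it acts as
  differentiation in \<open>x\<close> alone in the coordinates \<open>x\<close> and
  \<open>z\<close>.\<close>

definition varz :: "rat poly poly" where
  "varz = vary - varx"

lemma diffD_varx: "diffD varx = 1"
  by (simp add: diffD_def dx_def dy_def varx_def map_poly_pCons pderiv_pCons one_pCons)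

lemma diffD_vary: "diffD vary = 1"
  by (simp add: diffD_def dx_def dy_def vary_def map_poly_pCons pderiv_pCons one_pCons)

lemma diffD_varz: "diffD varz = 0"
  using diffD_add[of varz varx] by (simp add: varz_def diffD_varx diffD_vary)

lemma diffD_varz_power: "diffD (varz ^ l) = 0"
  by (induction l) (simp_all add: diffD_mult diffD_varz)

lemma diffD_varx_power: "diffD (varx ^ m) = of_nat m * varx ^ (m - 1)"
proof (induction m)
  case (Suc m)
  then show ?case by (cases m) (simp_all add: diffD_mult diffD_varx algebra_simps)
qed simp

lemma diffD_of_nat_mult: "diffD (of_nat c * p) = of_nat c * diffD p"
  by (simp add: diffD_mult)

lemma diffD_funpow_add: "(diffD ^^ j) (p + q) = (diffD ^^ j) p + (diffD ^^ j) q"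
  by (induction j) (simp_all add: diffD_add)

lemma diffD_funpow_of_nat_mult: "(diffD ^^ j) (of_nat c * p) = of_nat c * (diffD ^^ j) p"
  by (induction j) (simp_all add: diffD_of_nat_mult)

lemma opG_add: "opG r (p + q) = opG r p + opG r q"
  by (simp add: opG_def diffD_funpow_add smult_add_right distrib_left sum.distrib)

lemma opG_of_nat_mult: "opG r (of_nat c * p) = of_nat c * opG r p"
  by (simp add: opG_def diffD_funpow_of_nat_mult sum_distrib_left mult.left_commute)

lemma opG_0: "opG r 0 = 0"
  using opG_of_nat_mult[of r 0 0] by simp

lemma opG_sum: "opG r (\<Sum>i\<in>A. of_nat (c i) * p i) = (\<Sum>i\<in>A. of_nat (c i) * opG r (p i))"
  by (induction A rule: infinite_finite_induct) (simp_all add: opG_add opG_0 opG_of_nat_mult)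

text \<open>The falling factorial is written as \<open>fact j * (m choose j)\<close>, so that the
  factor cancels the \<open>1 / fact j\<close> in \<open>opG\<close> and vanishes for
  \<open>j > m\<close>.\<close>

lemma diffD_funpow_monom:
  "(diffD ^^ j) (varx ^ m * varz ^ l) =
    of_nat (fact j * (m choose j)) * (varx ^ (m - j) * varz ^ l)"
proof (induction j)
  case (Suc j)
  have "Suc j * (m choose Suc j) = (m - j) * (m choose j)"
    using binomial_absorption[of j m] binomial_absorb_comp[of m j] by simp
  then have *: "fact (Suc j) * (m choose Suc j) = fact j * (m choose j) * (m - j)"
    by (metis fact_Suc mult.assoc mult.commute of_nat_id)
  have "(diffD ^^ Suc j) (varx ^ m * varz ^ l) =
      of_nat (fact j * (m choose j)) * (of_nat (m - j) * varx ^ (m - j - 1) * varz ^ l)"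
    by (simp only: funpow.simps o_apply Suc diffD_of_nat_mult)
      (simp add: diffD_mult diffD_varx_power diffD_varz_power)
  also have "\<dots> = of_nat (fact (Suc j) * (m choose Suc j)) * (varx ^ (m - Suc j) * varz ^ l)"
    unfolding * by (simp add: mult.assoc)
  finally show ?case .
qed simp

lemma smult_of_nat: "smult [:of_nat n:] p = of_nat n * (p :: rat poly poly)"
  by (simp add: of_nat_poly)

lemma smult_inverse_fact:
  "smult [:1 / fact j:] (of_nat (fact j) * p) = (p :: rat poly poly)"
  unfolding smult_of_nat[symmetric] by (simp flip: one_pCons)

text \<open>Reflecting the first binomial turns the sum into a Vandermonde convolution.\<close>

lemma sum_choose_shift:
  assumes "0 < r"
  shows "(\<Sum>j = 1..r. ((r - 1) choose (j - 1)) * (m choose j)) = (m + r - 1) choose r"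
proof -
  have "(\<Sum>j = 1..r. ((r - 1) choose (j - 1)) * (m choose j)) =
      (\<Sum>j = 1..r. (m choose j) * ((r - 1) choose (r - j)))"
  proof (intro sum.cong refl)
    fix j assume "j \<in> {1..r}"
    then have "(r - 1) choose (j - 1) = (r - 1) choose (r - j)"
      by (subst binomial_symmetric) (auto intro: arg_cong2[of _ _ _ _ binomial])
    then show "((r - 1) choose (j - 1)) * (m choose j) = (m choose j) * ((r - 1) choose (r - j))"
      by simp
  qed
  \<comment> \<open>The added term \<open>j = 0\<close> contains \<open>(r - 1) choose r\<close>,
    which is zero for positive \<open>r\<close>.\<close>
  also have "\<dots> = (\<Sum>j\<le>r. (m choose j) * ((r - 1) choose (r - j)))"
    using assms by (intro sum.mono_neutral_left) (auto simp: binomial_eq_0)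
  also have "\<dots> = (m + (r - 1)) choose r" by (rule vandermonde)
  finally show ?thesis using assms by simp
qed

text \<open>Each \<open>x^j D^j\<close> has \<open>x^m z^l\<close> as an eigenvector, so the sum
  over \<open>j\<close> is a scalar, evaluated by \<open>sum_choose_shift\<close>.\<close>

lemma opG_monom:
  assumes "0 < m"
  shows "opG r (varx ^ m * varz ^ l) =
    of_nat ((m + r - 1) choose r) * (varx ^ m * varz ^ l * vary ^ r)"
proof (cases "r = 0")
  case False
  have "smult [:of_nat ((r - 1) choose (j - 1)):]
      (smult [:1 / fact j:] (varx ^ j) * (diffD ^^ j) (varx ^ m * varz ^ l)) =
      of_nat (((r - 1) choose (j - 1)) * (m choose j)) * (varx ^ m * varz ^ l)" for j
  proof (cases "j \<le> m")
    case True
    then have x: "varx ^ j * varx ^ (m - j) = varx ^ m" by (simp flip: power_add)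
    have "smult [:1 / fact j:] (varx ^ j) * (diffD ^^ j) (varx ^ m * varz ^ l) =
        smult [:1 / fact j:] (of_nat (fact j) * (of_nat (m choose j) * (varx ^ j * varx ^ (m - j) * varz ^ l)))"
      unfolding diffD_funpow_monom by (simp add: mult.assoc mult.left_commute)
    then show ?thesis unfolding smult_inverse_fact smult_of_nat x by (simp add: mult.assoc)
  qed (simp add: diffD_funpow_monom binomial_eq_0)
  then have "opG r (varx ^ m * varz ^ l) = vary ^ r * (\<Sum>j = 1..r.
      of_nat (((r - 1) choose (j - 1)) * (m choose j)) * (varx ^ m * varz ^ l))"
    using False by (simp add: opG_def)
  also have "\<dots> = vary ^ r * (of_nat (\<Sum>j = 1..r. ((r - 1) choose (j - 1)) * (m choose j)) *
      (varx ^ m * varz ^ l))"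
    by (simp only: of_nat_sum sum_distrib_right)
  finally show ?thesis unfolding sum_choose_shift[OF False[unfolded neq0_conv]] by (simp only: ac_simps)
qed (simp add: opG_def)

text \<open>The semiring is left general because the same regrouped coefficients occur twice: with
  polynomials \<open>g\<close>, and with binomial numbers \<open>g\<close> as test values.\<close>

lemma sum_regroup_by_total:
  fixes g :: "nat \<Rightarrow> 'a :: comm_semiring_1"
  shows "(\<Sum>i\<le>N. \<Sum>l\<le>r. of_nat (w i l) * g (i + l)) =
    (\<Sum>n\<le>N + r. of_nat (\<Sum>(i, l) | i \<le> N \<and> l \<le> r \<and> i + l = n. w i l) * g n)"
proof -
  let ?S = "{..N} \<times> {..r}"
  have "(\<Sum>i\<le>N. \<Sum>l\<le>r. of_nat (w i l) * g (i + l)) = (\<Sum>p\<in>?S. of_nat (case p of (i, l) \<Rightarrow> w i l) * g (fst p + snd p))"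
    by (subst sum.cartesian_product) (auto intro: sum.cong)
  also have "\<dots> = (\<Sum>n\<le>N + r. \<Sum>p | p \<in> ?S \<and> fst p + snd p = n. of_nat (case p of (i, l) \<Rightarrow> w i l) * g (fst p + snd p))"
    by (rule sum.group[symmetric]) auto
  also have "\<dots> = (\<Sum>n\<le>N + r. of_nat (\<Sum>(i, l) | i \<le> N \<and> l \<le> r \<and> i + l = n. w i l) * g n)"
  proof (intro sum.cong refl)
    fix n
    have "{p. p \<in> ?S \<and> fst p + snd p = n} = {(i, l). i \<le> N \<and> l \<le> r \<and> i + l = n}" by auto
    moreover have "(\<Sum>p | p \<in> ?S \<and> fst p + snd p = n. of_nat (case p of (i, l) \<Rightarrow> w i l) * g (fst p + snd p))
        = of_nat (\<Sum>p | p \<in> ?S \<and> fst p + snd p = n. case p of (i, l) \<Rightarrow> w i l) * g n"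
      by (simp add: sum_distrib_right)
    ultimately show "(\<Sum>p | p \<in> ?S \<and> fst p + snd p = n. of_nat (case p of (i, l) \<Rightarrow> w i l) * g (fst p + snd p))
        = of_nat (\<Sum>(i, l) | i \<le> N \<and> l \<le> r \<and> i + l = n. w i l) * g n" by simp
  qed
  finally show ?thesis .
qed

text \<open>The system is triangular: at \<open>k = M - n\<close> all terms with index below
  \<open>n\<close> vanish, and those above \<open>n\<close> agree by induction.\<close>

lemma binomial_sum_unique:
  fixes a b :: "nat \<Rightarrow> nat"
  assumes "\<And>k. (\<Sum>n\<le>M. a n * (k choose (M - n))) = (\<Sum>n\<le>M. b n * (k choose (M - n)))"
    and "n \<le> M"
  shows "a n = b n"
  using assms(2)
proof (induction "M - n" arbitrary: n rule: less_induct)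
  case less
  let ?k = "M - n"
  have split: "(\<Sum>i\<le>M. c i * (?k choose (M - i))) =
      c n + (\<Sum>i\<in>{..M} - {n}. c i * (?k choose (M - i)))" for c :: "nat \<Rightarrow> nat"
    using less.prems by (subst sum.remove[of _ n]) auto
  have "(\<Sum>i\<in>{..M} - {n}. a i * (?k choose (M - i))) = (\<Sum>i\<in>{..M} - {n}. b i * (?k choose (M - i)))"
  proof (intro sum.cong refl)
    fix i assume i: "i \<in> {..M} - {n}"
    show "a i * (?k choose (M - i)) = b i * (?k choose (M - i))"
    proof (cases "n < i")
      case True
      then have "a i = b i" using i by (intro less.hyps) auto
      then show ?thesis by simp
    next
      case False
      then have "(?k choose (M - i)) = 0" using i less.prems by (intro binomial_eq_0) auto
      then show ?thesis by simp
    qed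
  qed
  then show ?case using assms(1)[of ?k] unfolding split by simp
qed

section \<open>Comparing coefficients in powers of \<open>x\<close> and \<open>z\<close>\<close>

definition shape_poly :: "(nat \<Rightarrow> nat) \<Rightarrow> rat poly poly" where
  "shape_poly f = (\<Sum>T\<in>syt f.
     varx ^ (card (descents f T) + 1) * vary ^ (shape_size f - card (descents f T)))"

text \<open>This is the coefficient of \<open>x^(N - i + 1) z^i\<close> in
  \<open>shape_poly f\<close>, where \<open>N\<close> is the size of \<open>f\<close>. Keeping it a
  natural number allows comparison with tableau counts.\<close>

definition xz_coeff :: "(nat \<Rightarrow> nat) \<Rightarrow> nat \<Rightarrow> nat" where
  "xz_coeff f i = (\<Sum>T\<in>syt f. (shape_size f - card (descents f T)) choose i)"

lemma vary_power: "vary ^ r = (\<Sum>l\<le>r. of_nat (r choose l) * (varx ^ (r - l) * varz ^ l))"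
proof -
  have "vary ^ r = (varz + varx) ^ r" by (simp add: varz_def)
  then show ?thesis unfolding binomial_ring by (simp add: ac_simps)
qed

lemma shape_poly_expand:
  "shape_poly f = (\<Sum>i\<le>shape_size f. of_nat (xz_coeff f i) * (varx ^ (shape_size f - i + 1) * varz ^ i))"
proof -
  have *: "varx ^ (d + 1) * vary ^ (N - d) =
      (\<Sum>i\<le>N. of_nat ((N - d) choose i) * (varx ^ (N - i + 1) * varz ^ i))" if "d \<le> N" for d N
  proof -
    have "varx ^ (d + 1) * vary ^ (N - d) =
        (\<Sum>i\<le>N - d. of_nat ((N - d) choose i) * (varx ^ (d + 1) * varx ^ (N - d - i) * varz ^ i))"
      unfolding vary_power sum_distrib_left by (simp only: ac_simps)
    also have "\<dots> = (\<Sum>i\<le>N - d. of_nat ((N - d) choose i) * (varx ^ (N - i + 1) * varz ^ i))"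
      using that by (intro sum.cong refl) (auto simp flip: power_add)
    also have "\<dots> = (\<Sum>i\<le>N. of_nat ((N - d) choose i) * (varx ^ (N - i + 1) * varz ^ i))"
      by (rule sum.mono_neutral_left) (auto simp: binomial_eq_0)
    finally show ?thesis .
  qed
  have le: "card (descents f T) \<le> shape_size f" for T
    using card_descents_le[of f T] by simp
  show ?thesis unfolding shape_poly_def xz_coeff_def *[OF le] of_nat_sum sum_distrib_right
    by (rule sum.swap)
qed

text \<open>Vandermonde for the upper index \<open>(N - d) + k\<close>, with \<open>d\<close> the
  number of descents, produces exactly the coefficients of the expansion in \<open>x\<close> and
  \<open>z\<close>. This links the polynomial to the counting sequence.\<close>

lemma num_ssyt_xz_coeff:
  assumes "shape f"
  shows "num_ssyt (Suc k) f = (\<Sum>i\<le>shape_size f. xz_coeff f i * (k choose (shape_size f - i)))"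
proof -
  have "(shape_size f + k - card (descents f T)) choose shape_size f =
     (\<Sum>i\<le>shape_size f. ((shape_size f - card (descents f T)) choose i) * (k choose (shape_size f - i)))" for T
    unfolding vandermonde using card_descents_le[of f T] by simp
  then show ?thesis unfolding num_ssyt_eq_sum_syt[OF assms] xz_coeff_def sum_distrib_right
    by (simp only:) (rule sum.swap)
qed

text \<open>Trinomial revision; both sides are zero when \<open>N - i > k\<close>. It replaces a
  factor depending on \<open>i\<close> by one that depends only on \<open>k\<close> and
  \<open>r\<close>.\<close>

lemma choose_transfer:
  assumes "i \<le> N"
  shows "((N - i + r) choose r) * ((k + r) choose (N - i + r)) = ((k + r) choose r) * (k choose (N - i))"
proof (cases "N - i \<le> k")
  case True
  have "((k + r) choose (N - i + r)) * ((N - i + r) choose r) =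
      ((k + r) choose r) * ((k + r - r) choose (N - i + r - r))"
    by (rule choose_mult) (use True in auto)
  then show ?thesis by (simp add: mult.commute)
qed (simp add: binomial_eq_0)

text \<open>Evaluates the sum over \<open>l\<close> that arises from expanding \<open>y^r\<close> in
  \<open>x\<close> and \<open>z\<close>.\<close>

lemma vandermonde_shift:
  assumes "i \<le> N"
  shows "(\<Sum>l\<le>r. (r choose l) * (k choose (N + r - (i + l)))) = (k + r) choose (N - i + r)"
proof -
  have "(k + r) choose (N - i + r) = (\<Sum>l\<le>N - i + r. (r choose l) * (k choose (N - i + r - l)))"
    by (simp add: vandermonde add.commute)
  also have "\<dots> = (\<Sum>l\<le>r. (r choose l) * (k choose (N - i + r - l)))"
    by (rule sum.mono_neutral_right) (auto simp: binomial_eq_0)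
  also have "\<dots> = (\<Sum>l\<le>r. (r choose l) * (k choose (N + r - (i + l))))"
    using assms by (intro sum.cong refl) (simp add: algebra_simps)
  finally show ?thesis by simp
qed

lemma opG_shape_poly:
  assumes "shape f"
  shows "opG r (shape_poly f) = (\<Sum>g\<in>strips_above r f. shape_poly g)"
proof -
  let ?N = "shape_size f"
  let ?M = "?N + r"
  define w where "w = (\<lambda>i l. xz_coeff f i * ((?N - i + r) choose r) * (r choose l))"
  define G where "G = (\<lambda>n. varx ^ (?M - n + 1) * varz ^ n)"
  \<comment> \<open>\<open>R n\<close> and \<open>P n\<close> are the coefficients of
    \<open>G n\<close> in the left and right sides of the claim.\<close>
  define R where "R = (\<lambda>n. \<Sum>(i, l) | i \<le> ?N \<and> l \<le> r \<and> i + l = n. w i l)"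
  define P where "P = (\<lambda>n. \<Sum>g\<in>strips_above r f. xz_coeff g n)"
  have above: "shape g" "shape_size g = ?M" if "g \<in> strips_above r f" for g
    using that assms interlace_shape_above by (auto simp: strips_above_def)
  have opG_xz: "opG r (varx ^ (?N - i + 1) * varz ^ i) =
      (\<Sum>l\<le>r. of_nat (((?N - i + r) choose r) * (r choose l)) * G (i + l))" if "i \<le> ?N" for i
  proof -
    have "opG r (varx ^ (?N - i + 1) * varz ^ i) =
        of_nat ((?N - i + r) choose r) * (varx ^ (?N - i + 1) * varz ^ i * vary ^ r)"
      by (subst opG_monom) simp_all
    also have "\<dots> = (\<Sum>l\<le>r. of_nat (((?N - i + r) choose r) * (r choose l)) *
        ((varx ^ (?N - i + 1) * varx ^ (r - l)) * (varz ^ i * varz ^ l)))"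
      unfolding vary_power sum_distrib_left of_nat_mult by (simp only: ac_simps)
    also have "\<dots> = (\<Sum>l\<le>r. of_nat (((?N - i + r) choose r) * (r choose l)) * G (i + l))"
      unfolding G_def power_add[symmetric] using that by (intro sum.cong refl) simp
    finally show ?thesis .
  qed
  have "opG r (shape_poly f) = (\<Sum>i\<le>?N. \<Sum>l\<le>r. of_nat (w i l) * G (i + l))"
    unfolding shape_poly_expand opG_sum w_def
    by (intro sum.cong refl) (simp only: atMost_iff opG_xz sum_distrib_left of_nat_mult mult.assoc)
  also have "\<dots> = (\<Sum>n\<le>?M. of_nat (R n) * G n)" unfolding R_def by (rule sum_regroup_by_total)
  also have "\<dots> = (\<Sum>n\<le>?M. of_nat (P n) * G n)"
  proof -
    \<comment> \<open>Equality of the coefficients is tested against the binomials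
      \<open>k choose (?M - n)\<close> for all \<open>k\<close>; there both sides become tableau
      counts and the Pieri rule applies.\<close>
    have "(\<Sum>n\<le>?M. R n * (k choose (?M - n))) = (\<Sum>n\<le>?M. P n * (k choose (?M - n)))" for k
    proof -
      have "(\<Sum>n\<le>?M. R n * (k choose (?M - n))) = (\<Sum>i\<le>?N. \<Sum>l\<le>r. w i l * (k choose (?M - (i + l))))"
        unfolding R_def
        using sum_regroup_by_total[of w "\<lambda>n. k choose (?M - n)" r ?N] by simp
      also have "\<dots> = (\<Sum>i\<le>?N. xz_coeff f i * (((?N - i + r) choose r) *
          (\<Sum>l\<le>r. (r choose l) * (k choose (?M - (i + l))))))"
        by (simp add: w_def sum_distrib_left mult.assoc)
      also have "\<dots> = (\<Sum>i\<le>?N. ((k + r) choose r) * (xz_coeff f i * (k choose (?N - i))))"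
        by (intro sum.cong refl) (simp only: atMost_iff vandermonde_shift choose_transfer mult.left_commute)
      also have "\<dots> = ((Suc k + r - 1) choose r) * num_ssyt (Suc k) f"
        unfolding num_ssyt_xz_coeff[OF assms] by (simp add: sum_distrib_left)
      also have "\<dots> = (\<Sum>g\<in>strips_above r f. num_ssyt (Suc k) g)"
        by (rule num_ssyt_pieri[OF assms, symmetric])
      also have "\<dots> = (\<Sum>g\<in>strips_above r f. \<Sum>n\<le>?M. xz_coeff g n * (k choose (?M - n)))"
        by (intro sum.cong refl) (simp only: num_ssyt_xz_coeff above)
      also have "\<dots> = (\<Sum>n\<le>?M. P n * (k choose (?M - n)))"
        unfolding P_def sum_distrib_right by (rule sum.swap)
      finally show ?thesis .
    qed
    then show ?thesis using binomial_sum_unique[where M = ?M and a = R and b = P] by (intro sum.cong refl) simp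
  qed
  also have "\<dots> = (\<Sum>g\<in>strips_above r f. \<Sum>n\<le>?M. of_nat (xz_coeff g n) * G n)"
    unfolding P_def of_nat_sum sum_distrib_right by (rule sum.swap)
  also have "\<dots> = (\<Sum>g\<in>strips_above r f. shape_poly g)"
    unfolding G_def by (intro sum.cong refl) (simp only: shape_poly_expand above)
  finally show ?thesis .
qed

section \<open>Partitions as lists\<close>

definition row_length :: "nat list \<Rightarrow> nat \<Rightarrow> nat" where
  "row_length lam i = (if i < length lam then lam ! i else 0)"

lemma diagram_eq_cells: "diagram lam = cells (row_length lam)"
  by (auto simp: diagram_def cells_def row_length_def split: if_splits)

lemma sum_list_eq_shape_size: "sum_list lam = shape_size (row_length lam)"
  by (subst shape_size_eq[of "length lam"])
    (auto simp: row_length_def sum_list_sum_nth atLeast0LessThan)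

lemma SYT_eq_syt: "SYT lam = syt (row_length lam)"
  by (simp add: SYT_def syt_def diagram_eq_cells sum_list_eq_shape_size)

lemma Des_eq_descents:
  assumes "T \<in> syt (row_length lam)"
  shows "Des lam T = descents (row_length lam) T"
proof (intro set_eqI)
  fix k
  show "k \<in> Des lam T \<longleftrightarrow> k \<in> descents (row_length lam) T"
  proof (cases "k \<in> {1..<sum_list lam}")
    case True
    let ?f = "row_length lam"
    obtain p where p: "p \<in> cells ?f" "T p = k"
      by (rule syt_obtain[OF assms, of k]) (use True in \<open>simp_all add: sum_list_eq_shape_size\<close>)
    obtain q where q: "q \<in> cells ?f" "T q = Suc k"
      by (rule syt_obtain[OF assms, of "Suc k"]) (use True in \<open>simp_all add: sum_list_eq_shape_size\<close>)
    have row: "fst c = row_of ?f T (T c)" if "c \<in> cells ?f" for c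
      using row_of_eq[OF assms that] by simp
    have "(\<exists>c\<in>cells ?f. \<exists>d\<in>cells ?f. T c = k \<and> T d = k + 1 \<and> fst c < fst d) \<longleftrightarrow>
        row_of ?f T k < row_of ?f T (Suc k)"
      using p q row by (metis Suc_eq_plus1)
    then show ?thesis
      using True by (simp add: Des_def descents_def diagram_eq_cells sum_list_eq_shape_size)
  qed (auto simp: Des_def descents_def sum_list_eq_shape_size)
qed

lemma Ypoly_eq_shape_poly: "Ypoly lam = shape_poly (row_length lam)"
  unfolding Ypoly_def shape_poly_def SYT_eq_syt
  by (intro sum.cong refl) (simp add: Des_eq_descents sum_list_eq_shape_size)

lemma shape_row_length:
  assumes "is_partition lam"
  shows "shape (row_length lam)"
  unfolding shape_alt
proof (intro conjI allI exI impI)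
  fix i
  show "row_length lam (Suc i) \<le> row_length lam i"
    using assms by (auto simp: row_length_def is_partition_def sorted_wrt_iff_nth_less)
  show "row_length lam i = 0" if "length lam \<le> i"
    using that by (simp add: row_length_def)
qed

lemma row_length_pos_iff:
  assumes "is_partition lam"
  shows "0 < row_length lam i \<longleftrightarrow> i < length lam"
  using assms by (auto simp: row_length_def is_partition_def)

lemma inj_on_row_length: "inj_on row_length {lam. is_partition lam}"
proof (rule inj_onI)
  fix a b assume "a \<in> {lam. is_partition lam}" "b \<in> {lam. is_partition lam}"
    and eq: "row_length a = row_length b"
  then have "i < length a \<longleftrightarrow> i < length b" for i
    using row_length_pos_iff by (metis mem_Collect_eq)
  then have len: "length a = length b" by (meson linorder_neqE_nat less_irrefl)
  show "a = b"
  proof (rule nth_equalityI[OF len])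
    fix i assume "i < length a"
    then show "a ! i = b ! i" using fun_cong[OF eq, of i] len by (simp add: row_length_def)
  qed
qed

lemma shape_imp_row_length:
  assumes "shape f"
  obtains lam where "is_partition lam" "row_length lam = f"
proof -
  obtain n where "\<forall>i\<ge>n. f i = 0" using assms unfolding shape_alt by blast
  then have ex: "f n = 0" by simp
  \<comment> \<open>The first zero row gives the number of parts; by monotonicity all later rows are
    zero too.\<close>
  define l where "l = (LEAST n. f n = 0)"
  have l: "f l = 0" unfolding l_def by (rule LeastI) fact
  have pos: "0 < f i" if "i < l" for i using not_less_Least that unfolding l_def by blast
  have zero: "f i = 0" if "i \<ge> l" for i using shape_antimono[OF assms that] l by simp
  let ?lam = "map f [0..<l]"
  have "is_partition ?lam"
    using pos shape_antimono[OF assms] by (auto simp: is_partition_def sorted_wrt_iff_nth_less)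
  moreover have "row_length ?lam = f" using zero by (auto simp: row_length_def fun_eq_iff)
  ultimately show ?thesis using that by blast
qed

text \<open>If \<open>?g (Suc i) > ?f i\<close>, then column \<open>?f i\<close> has new cells in
  rows \<open>i\<close> and \<open>Suc i\<close>. Conversely, two new cells in one column would
  force such a violation just below the upper one.\<close>

lemma horizontal_strip_iff:
  assumes "is_partition lam" "is_partition nu"
  shows "horizontal_strip lam nu r \<longleftrightarrow> row_length nu \<in> strips_above r (row_length lam)"
proof -
  let ?f = "row_length lam" and ?g = "row_length nu"
  have f: "shape ?f" and g: "shape ?g" using assms shape_row_length by blast+
  have sub: "cells ?f \<subseteq> cells ?g \<longleftrightarrow> (\<forall>i. ?f i \<le> ?g i)"
  proof
    assume *: "cells ?f \<subseteq> cells ?g"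
    have "?f i \<le> ?g i" for i
    proof (rule ccontr)
      assume "\<not> ?f i \<le> ?g i"
      then have "(i, ?g i) \<in> cells ?f" by simp
      then show False using * by fastforce
    qed
    then show "\<forall>i. ?f i \<le> ?g i" by blast
  qed (auto simp: cells_def intro: less_le_trans)
  have inj: "inj_on snd (cells ?g - cells ?f) \<longleftrightarrow> (\<forall>i. ?g (Suc i) \<le> ?f i)"
  proof
    assume *: "inj_on snd (cells ?g - cells ?f)"
    have "?g (Suc i) \<le> ?f i" for i
    proof (rule ccontr)
      assume "\<not> ?g (Suc i) \<le> ?f i"
      then have "(i, ?f i) \<in> cells ?g - cells ?f" "(Suc i, ?f i) \<in> cells ?g - cells ?f"
        using shape_antimono[OF f, of i "Suc i"] shape_antimono[OF g, of i "Suc i"] by auto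
      then show False using inj_onD[OF *, of "(i, ?f i)" "(Suc i, ?f i)"] by simp
    qed
    then show "\<forall>i. ?g (Suc i) \<le> ?f i" by blast
  next
    assume *: "\<forall>i. ?g (Suc i) \<le> ?f i"
    have False if "i < i'" "j < ?g i'" "\<not> j < ?f i" for i i' j
    proof -
      have "?g i' \<le> ?g (Suc i)" using that shape_antimono[OF g, of "Suc i" i'] by simp
      then show False using that * by (meson leD le_trans not_less)
    qed
    then have "i = i'" if "(i, j) \<in> cells ?g - cells ?f" "(i', j) \<in> cells ?g - cells ?f" for i i' j
      using that by (metis DiffD1 DiffD2 cells_iff linorder_neqE_nat)
    then show "inj_on snd (cells ?g - cells ?f)" by (intro inj_onI) (metis prod.collapse)
  qed
  have card: "card (cells ?g - cells ?f) = r \<longleftrightarrow> shape_size ?g = shape_size ?f + r"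
    if "cells ?f \<subseteq> cells ?g"
    using card_Diff_subset[OF finite_cells[OF f] that] card_mono[OF finite_cells[OF g] that]
      card_cells[OF f] card_cells[OF g] by auto
  have "horizontal_strip lam nu r \<longleftrightarrow> cells ?f \<subseteq> cells ?g \<and>
      shape_size ?g = shape_size ?f + r \<and> inj_on snd (cells ?g - cells ?f)"
    unfolding horizontal_strip_def diagram_eq_cells using card by blast
  then show ?thesis unfolding sub inj strips_above_def interlace_def by auto
qed

theorem theorem17:
  fixes lam :: "nat list" and N r :: nat
  assumes "partition_of lam N"
  shows "opG r (Ypoly lam) =
    (\<Sum>nu | is_partition nu \<and> horizontal_strip lam nu r. Ypoly nu)"
proof -
  have lam: "is_partition lam" using assms by (simp add: partition_of_def)
  let ?S = "{nu. is_partition nu \<and> horizontal_strip lam nu r}"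
  \<comment> \<open>Partitions as lists correspond bijectively to shapes, so the sum over
    \<open>nu\<close> can be reindexed by row-length functions.\<close>
  have "row_length ` ?S = strips_above r (row_length lam)"
  proof
    show "row_length ` ?S \<subseteq> strips_above r (row_length lam)"
      using horizontal_strip_iff[OF lam] by auto
    show "strips_above r (row_length lam) \<subseteq> row_length ` ?S"
    proof
      fix g assume g: "g \<in> strips_above r (row_length lam)"
      then have "shape g"
        using interlace_shape_above shape_row_length[OF lam] by (auto simp: strips_above_def)
      then obtain nu where "is_partition nu" "row_length nu = g" by (rule shape_imp_row_length)
      then show "g \<in> row_length ` ?S" using horizontal_strip_iff[OF lam] g by auto
    qed
  qed
  moreover have "inj_on row_length ?S" using inj_on_row_length by (rule inj_on_subset) auto
  ultimately have "bij_betw row_length ?S (strips_above r (row_length lam))"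
    by (simp add: bij_betw_def)
  then have "(\<Sum>nu\<in>?S. shape_poly (row_length nu)) =
      (\<Sum>g\<in>strips_above r (row_length lam). shape_poly g)"
    by (rule sum.reindex_bij_betw)
  then show ?thesis
    unfolding Ypoly_eq_shape_poly opG_shape_poly[OF shape_row_length[OF lam]] by simp
qed

end
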